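(* Let $P$ be a convex polytopal complex in $\mathbb{R}^d$, let $P_0$ be its set of vertices and let $P_{max}$ be its set of maximal polytopes (those not properly contained in another polytope of $P$). Let $R \subset P_0 \times P_{max}$ be the relation defined by $x R p$ if and only if $x \in p$. Then (the underlying space of) $P$ is homotopy equivalent to $|K_R|$.
   Context: A convex polytopal complex is a finite collection $\mathcal{C}$ of convex polytopes in $\mathbb{R}^d$ such that: the empty polytope is in $\mathcal{C}$; if $P \in \mathcal{C}$ then all faces of $P$ are in $\mathcal{C}$; and for any $P, Q \in \mathcal{C}$ the intersection $P \cap Q$ is a face of both $P$ and $Q$, or empty. Its underlying space is the union of its polytopes, as a subspace of $\mathbb{R}^d$. For a relation $R \subset X \times Y$ between finite sets, the Dowker complex $K_R$ is the abstract simplicial complex with vertices in $X$ such that $[x_1, \ldots, x_n] \in K_R$ if and only if there exists $y \in Y$ with $x_i R y$ for all $i$. $|\cdot|$ denotes geometric realization. *)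

theory Defs
  imports "HOL-Analysis.Analysis"
begin

(* Following face_of, the empty set and the polytope itself count as faces. *)
definition convex_polytopal_complex :: "'a::euclidean_space set set \<Rightarrow> bool" where
  "convex_polytopal_complex C \<longleftrightarrow>
     finite C \<and>
     (\<forall>S\<in>C. polytope S) \<and>
     {} \<in> C \<and>
     (\<forall>S\<in>C. \<forall>F. F face_of S \<longrightarrow> F \<in> C) \<and>
     (\<forall>S\<in>C. \<forall>T\<in>C. (S \<inter> T face_of S \<and> S \<inter> T face_of T) \<or> S \<inter> T = {})"

definition underlying_space :: "'a::euclidean_space set set \<Rightarrow> 'a topology" where
  "underlying_space C = top_of_set (\<Union>C)"

(* The vertices of a complex are its 0-dimensional polytopes, given here as points. *)
definition complex_vertices :: "'a::euclidean_space set set \<Rightarrow> 'a set" where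
  "complex_vertices C = {v. {v} \<in> C}"

definition maximal_polytopes :: "'a::euclidean_space set set \<Rightarrow> 'a set set" where
  "maximal_polytopes C = {S \<in> C. \<not> (\<exists>T\<in>C. S \<subset> T)}"

(* An abstract simplicial complex is represented by the set of its nonempty simplices. *)
definition dowker_complex :: "'x set \<Rightarrow> 'y set \<Rightarrow> ('x \<times> 'y) set \<Rightarrow> 'x set set" where
  "dowker_complex X Y R =
     {s. s \<subseteq> X \<and> finite s \<and> s \<noteq> {} \<and> (\<exists>y\<in>Y. \<forall>x\<in>s. (x, y) \<in> R)}"

(* Points are barycentric coordinate functions, whose support is required to be a simplex.
   The topology of pointwise convergence is the usual topology of the geometric realization
   when K is finite; for infinite K it may be coarser than the weak topology. *)
definition geometric_realization :: "'x set set \<Rightarrow> ('x \<Rightarrow> real) topology" where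
  "geometric_realization K =
     subtopology (powertop_real UNIV)
       {f. (\<forall>x. 0 \<le> f x) \<and> {x. f x \<noteq> 0} \<in> K \<and> (\<Sum>x | f x \<noteq> 0. f x) = 1}"

end

theory Submission
  imports Defs
begin

text \<open>
  Both homotopies are straight lines, so it suffices to have continuous maps in both directions
  that respect the polytopes. Realization to space: send barycentric coordinates to the point with
  these coordinates. Space to realization: weight the vertex \<open>v\<close> at \<open>x\<close> by the distance from
  \<open>x\<close> to the union of the polytopes avoiding \<open>v\<close>, and normalize. A vertex of positive weight lies
  in every polytope containing \<open>x\<close>, and the vertices of the smallest such polytope do have
  positive weight.
\<close>

lemma finite_complex_vertices:
  assumes "finite C"
  shows "finite (complex_vertices C)"
proof -
  have "complex_vertices C = (\<lambda>v. {v}) -` C"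
    by (auto simp: complex_vertices_def)
  then show ?thesis
    using assms by (simp add: finite_vimageI inj_def)
qed

text \<open>Lets any polytope of \<open>C\<close> stand in for a maximal one when testing for Dowker
  simplices.\<close>

lemma maximal_polytope_above:
  assumes "finite C" "S \<in> C"
  obtains M where "M \<in> maximal_polytopes C" "S \<subseteq> M"
proof -
  obtain M where "M \<in> C" "S \<subseteq> M" "\<forall>T\<in>C. M \<subseteq> T \<longrightarrow> T = M"
    using finite_has_maximal2[OF assms] by metis
  then have "M \<in> maximal_polytopes C"
    by (auto simp: maximal_polytopes_def)
  with \<open>S \<subseteq> M\<close> show ?thesis
    using that by blast
qed

text \<open>A minimal polytope containing \<open>x\<close> is contained in every polytope containing
  \<open>x\<close>, because its intersection with another one is again a polytope of the complex
  through \<open>x\<close>. Any of its extreme points therefore serves.\<close>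

lemma exists_common_vertex:
  assumes C: "convex_polytopal_complex C" and x: "x \<in> \<Union>C"
  obtains v where "v \<in> complex_vertices C" "\<And>S. \<lbrakk>S \<in> C; x \<in> S\<rbrakk> \<Longrightarrow> v \<in> S"
proof -
  have "finite {S \<in> C. x \<in> S}" "{S \<in> C. x \<in> S} \<noteq> {}"
    using C x by (auto simp: convex_polytopal_complex_def)
  then obtain S where S: "S \<in> C" "x \<in> S"
      and minimal: "\<And>T. \<lbrakk>T \<in> C; x \<in> T; T \<subseteq> S\<rbrakk> \<Longrightarrow> T = S"
    using finite_has_minimal[of "{S \<in> C. x \<in> S}"] by auto
  have "polytope S"
    using C S by (auto simp: convex_polytopal_complex_def)
  then obtain v where v: "v extreme_point_of S"
    using S extreme_point_exists_convex[of S] polytope_imp_compact polytope_imp_convex by blast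
  then have "{v} face_of S"
    by (simp add: face_of_singleton)
  then have "v \<in> complex_vertices C"
    using C S by (auto simp: complex_vertices_def convex_polytopal_complex_def)
  moreover have "v \<in> T" if T: "T \<in> C" "x \<in> T" for T
  proof -
    \<comment> \<open>The point \<open>x\<close> lies in the intersection, which excludes the
      alternative that it is empty.\<close>
    have "S \<inter> T face_of S"
      using C S T unfolding convex_polytopal_complex_def by blast
    then have "S \<inter> T \<in> C"
      using C S by (auto simp: convex_polytopal_complex_def)
    then have "S \<inter> T = S"
      using minimal S T by blast
    then show ?thesis
      using v by (auto simp: extreme_point_of_def)
  qed
  ultimately show ?thesis
    using that by blast
qed

text \<open>\<open>infdist\<close> to the empty set is 0, so a vertex common to all nonempty
  polytopes would get weight 0 without the separate value 1.\<close>

definition weight :: "'a::euclidean_space set set \<Rightarrow> 'a \<Rightarrow> 'a \<Rightarrow> real" where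
  "weight C v x =
     (let A = \<Union>{S \<in> C. v \<notin> S} in if A = {} then 1 else infdist x A)"

lemma weight_nonneg: "0 \<le> weight C v x"
  by (simp add: weight_def Let_def infdist_nonneg)

lemma continuous_on_weight [continuous_intros]: "continuous_on S (weight C v)"
  unfolding weight_def Let_def
  by (cases "\<Union>{S \<in> C. v \<notin> S} = {}") (simp_all only: simp_thms if_True if_False continuous_intros)

text \<open>A finite union of closed sets is closed, so distance 0 to it amounts to membership. If
  the union is empty, the weight is 1 and the right-hand side holds as well.\<close>

lemma weight_pos_iff:
  assumes "finite C" "\<And>S. S \<in> C \<Longrightarrow> closed S"
  shows "0 < weight C v x \<longleftrightarrow> (\<forall>S\<in>C. x \<in> S \<longrightarrow> v \<in> S)"
proof -
  let ?A = "\<Union>{S \<in> C. v \<notin> S}"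
  have "closed ?A"
    using assms by (intro closed_Union) auto
  then have "?A \<noteq> {} \<Longrightarrow> 0 < infdist x ?A \<longleftrightarrow> x \<notin> ?A"
    using in_closed_iff_infdist_zero[of ?A x] infdist_nonneg[of x ?A] by linarith
  then show ?thesis
    by (auto simp: weight_def Let_def)
qed

lemma convex_polytopal_complex_weight_pos_iff:
  assumes "convex_polytopal_complex C"
  shows "0 < weight C v x \<longleftrightarrow> (\<forall>S\<in>C. x \<in> S \<longrightarrow> v \<in> S)"
  using assms
  by (intro weight_pos_iff) (auto simp: convex_polytopal_complex_def polytope_imp_closed)

definition coordinates :: "'a::euclidean_space set set \<Rightarrow> 'a \<Rightarrow> 'a \<Rightarrow> real" where
  "coordinates C x v =
     (if v \<in> complex_vertices C then weight C v x / (\<Sum>u\<in>complex_vertices C. weight C u x) else 0)"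

definition barycenter :: "'a::euclidean_space set set \<Rightarrow> ('a \<Rightarrow> real) \<Rightarrow> 'a" where
  "barycenter C f = (\<Sum>v\<in>complex_vertices C. f v *\<^sub>R v)"

text \<open>For finite \<open>C\<close> this is the full simplex on the vertices in
  \<open>S\<close>, whatever the shape of \<open>S\<close>. Summing over the fixed set of all
  vertices instead of the support makes the last condition affine in \<open>f\<close>.\<close>

definition vertex_distributions :: "'a::euclidean_space set set \<Rightarrow> 'a set \<Rightarrow> ('a \<Rightarrow> real) set" where
  "vertex_distributions C S =
     {f. (\<forall>v. 0 \<le> f v) \<and> {v. f v \<noteq> 0} \<subseteq> complex_vertices C \<inter> S \<and>
         (\<Sum>v\<in>complex_vertices C. f v) = 1}"

text \<open>Since each polytope lies in a maximal one, a nonempty set of vertices is a Dowker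
  simplex as soon as some polytope of \<open>C\<close> contains it. The realization is thus a union
  of full simplices, one for each polytope.\<close>

lemma geometric_realization_eq:
  assumes "finite C"
    and "R = {(x, p). x \<in> complex_vertices C \<and> p \<in> maximal_polytopes C \<and> x \<in> p}"
  shows "geometric_realization (dowker_complex (complex_vertices C) (maximal_polytopes C) R) =
         top_of_set (\<Union>S\<in>C. vertex_distributions C S)"
proof -
  let ?V = "complex_vertices C"
  let ?K = "dowker_complex ?V (maximal_polytopes C) R"
  have fin: "finite ?V"
    using assms by (simp add: finite_complex_vertices)
  have K: "s \<in> ?K \<longleftrightarrow> s \<noteq> {} \<and> (\<exists>S\<in>C. s \<subseteq> ?V \<inter> S)" for s
  proof
    assume "s \<in> ?K"
    then show "s \<noteq> {} \<and> (\<exists>S\<in>C. s \<subseteq> ?V \<inter> S)"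
      using assms(2) by (auto simp: dowker_complex_def maximal_polytopes_def)
  next
    assume s: "s \<noteq> {} \<and> (\<exists>S\<in>C. s \<subseteq> ?V \<inter> S)"
    then obtain S where S: "S \<in> C" "s \<subseteq> ?V \<inter> S"
      by blast
    obtain M where M: "M \<in> maximal_polytopes C" "S \<subseteq> M"
      using maximal_polytope_above assms(1) S(1) by blast
    then have "\<forall>x\<in>s. (x, M) \<in> R"
      using S(2) assms(2) by auto
    then show "s \<in> ?K"
      using s S(2) M(1) fin finite_subset[of s ?V] by (auto simp: dowker_complex_def)
  qed
  have "((\<forall>x. 0 \<le> f x) \<and> {x. f x \<noteq> 0} \<in> ?K \<and> (\<Sum>x | f x \<noteq> 0. f x) = 1) \<longleftrightarrow>
        (\<exists>S\<in>C. f \<in> vertex_distributions C S)" for f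
  proof (cases "{x. f x \<noteq> 0} \<subseteq> ?V")
    case True
    then have sum: "(\<Sum>x | f x \<noteq> 0. f x) = (\<Sum>x\<in>?V. f x)"
      using fin by (intro sum.mono_neutral_left) auto
    \<comment> \<open>Simplices are nonempty by definition; for a support this is automatic, as an
      empty sum is not 1.\<close>
    have "{x. f x \<noteq> 0} \<noteq> {}" if "(\<Sum>x\<in>?V. f x) = 1"
      using that sum by force
    then show ?thesis
      unfolding vertex_distributions_def K sum by blast
  qed (auto simp: K vertex_distributions_def)
  then have "{f. (\<forall>x. 0 \<le> f x) \<and> {x. f x \<noteq> 0} \<in> ?K \<and> (\<Sum>x | f x \<noteq> 0. f x) = 1} =
             (\<Union>S\<in>C. vertex_distributions C S)"
    by auto
  \<comment> \<open>The product topology over all indices is the standard topology of the function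
    type, hence \<open>top_of_set\<close>.\<close>
  then show ?thesis
    by (simp add: geometric_realization_def euclidean_product_topology)
qed

text \<open>The vertex common to all polytopes through \<open>x\<close> contributes a positive term.
  This makes the normalization in \<open>coordinates\<close> legitimate.\<close>

lemma sum_weight_pos:
  assumes "convex_polytopal_complex C" "x \<in> \<Union>C"
  shows "0 < (\<Sum>v\<in>complex_vertices C. weight C v x)"
proof -
  obtain v where "v \<in> complex_vertices C" "\<And>S. \<lbrakk>S \<in> C; x \<in> S\<rbrakk> \<Longrightarrow> v \<in> S"
    using exists_common_vertex[OF assms] by blast
  then show ?thesis
    using assms(1) finite_complex_vertices[of C]
    by (intro sum_pos2[of _ v])
       (auto simp: convex_polytopal_complex_weight_pos_iff weight_nonneg
         convex_polytopal_complex_def)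
qed

lemma coordinates_in_vertex_distributions:
  assumes C: "convex_polytopal_complex C" and "S \<in> C" "x \<in> S"
  shows "coordinates C x \<in> vertex_distributions C S"
proof -
  have pos: "0 < (\<Sum>v\<in>complex_vertices C. weight C v x)"
    using sum_weight_pos assms by blast
  have "v \<in> S" if "weight C v x \<noteq> 0" for v
    using that assms weight_nonneg[of C v x] convex_polytopal_complex_weight_pos_iff[OF C, of v x]
    by auto
  then show ?thesis
    using pos
    by (auto simp: vertex_distributions_def coordinates_def weight_nonneg split: if_splits
        simp flip: sum_divide_distrib)
qed

lemma continuous_on_coordinates:
  assumes "convex_polytopal_complex C"
  shows "continuous_on (\<Union>C) (coordinates C)"
proof (rule continuous_on_coordinatewise_then_product)
  fix v
  have "(\<Sum>u\<in>complex_vertices C. weight C u x) \<noteq> 0" if "x \<in> \<Union>C" for x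
    using sum_weight_pos[OF assms that] by simp
  then show "continuous_on (\<Union>C) (\<lambda>x. coordinates C x v)"
    unfolding coordinates_def
    by (cases "v \<in> complex_vertices C") (auto intro!: continuous_intros)
qed

lemma barycenter_in_polytope:
  assumes "finite C" "convex S" "f \<in> vertex_distributions C S"
  shows "barycenter C f \<in> S"
proof -
  let ?V = "complex_vertices C"
  \<comment> \<open>Vertices outside \<open>S\<close> have coefficient 0; dropping them leaves a
    convex combination of points of \<open>S\<close>.\<close>
  have "barycenter C f = (\<Sum>v\<in>?V \<inter> S. f v *\<^sub>R v)"
    using assms finite_complex_vertices[of C] unfolding barycenter_def vertex_distributions_def
    by (intro sum.mono_neutral_right) auto
  moreover have "sum f (?V \<inter> S) = sum f ?V"
    using assms finite_complex_vertices[of C] unfolding vertex_distributions_def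
    by (intro sum.mono_neutral_left) auto
  ultimately show ?thesis
    using assms finite_complex_vertices[of C]
    by (auto simp: vertex_distributions_def intro!: convex_sum)
qed

lemma continuous_on_barycenter: "continuous_on A (barycenter C)"
  unfolding barycenter_def
  by (intro continuous_intros continuous_on_product_then_coordinatewise[of A "\<lambda>f. f"])

lemma vertex_distributions_convex_combination:
  assumes "f \<in> vertex_distributions C S" "g \<in> vertex_distributions C S" "0 \<le> t" "t \<le> 1"
  shows "(\<lambda>v. (1 - t) * f v + t * g v) \<in> vertex_distributions C S"
proof -
  let ?h = "\<lambda>v. (1 - t) * f v + t * g v"
  have "{v. ?h v \<noteq> 0} \<subseteq> {v. f v \<noteq> 0} \<union> {v. g v \<noteq> 0}"
    by auto
  then have "{v. ?h v \<noteq> 0} \<subseteq> complex_vertices C \<inter> S"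
    using assms(1,2) unfolding vertex_distributions_def by blast
  then show ?thesis
    using assms by (simp add: vertex_distributions_def sum.distrib flip: sum_distrib_left)
qed

text \<open>Functions carry the product topology, so continuity of the straight-line homotopy is
  checked one coordinate at a time, without a norm.\<close>

lemma homotopic_with_canon_pointwise_linear:
  fixes f g :: "'b::topological_space \<Rightarrow> 'c \<Rightarrow> real"
  assumes f: "continuous_on A f" and g: "continuous_on A g"
    and B: "\<And>x t. \<lbrakk>x \<in> A; 0 \<le> t; t \<le> 1\<rbrakk> \<Longrightarrow> (\<lambda>v. (1 - t) * f x v + t * g x v) \<in> B"
  shows "homotopic_with_canon (\<lambda>_. True) A B f g"
proof -
  let ?h = "\<lambda>p v. (1 - fst p) * f (snd p) v + fst p * g (snd p) v"
  have "continuous_on ({0..1} \<times> A) (\<lambda>p. k (snd p) v)" if "continuous_on A k"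
    for k :: "'b \<Rightarrow> 'c \<Rightarrow> real" and v
    by (rule continuous_on_compose2[OF continuous_on_product_then_coordinatewise[OF that]])
       (auto intro: continuous_intros)
  then have "continuous_on ({0..1} \<times> A) ?h"
    using f g by (intro continuous_on_coordinatewise_then_product continuous_intros) auto
  then show ?thesis
    unfolding homotopic_with_def using B
    by (intro exI[of _ ?h]) (auto simp: prod_topology_subtopology_eu)
qed

theorem lemma5p4:
  fixes P :: "'a::euclidean_space set set"
    and R :: "('a \<times> 'a set) set"
  assumes "convex_polytopal_complex P"
    and "R = {(x, p). x \<in> complex_vertices P \<and> p \<in> maximal_polytopes P \<and> x \<in> p}"
  shows "underlying_space P homotopy_equivalent_space
         geometric_realization (dowker_complex (complex_vertices P) (maximal_polytopes P) R)"
proof -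
  let ?X = "\<Union>P" and ?K = "\<Union>S\<in>P. vertex_distributions P S"
  have fin: "finite P" and convex: "\<And>S. S \<in> P \<Longrightarrow> convex S"
    using assms(1) by (auto simp: convex_polytopal_complex_def polytope_imp_convex)
  note coordinates = coordinates_in_vertex_distributions[OF assms(1)]
  note barycenter = barycenter_in_polytope[OF fin convex]
  have contX: "continuous_on ?X (coordinates P)" "coordinates P \<in> ?X \<rightarrow> ?K"
    using continuous_on_coordinates[OF assms(1)] coordinates by auto
  have contK: "continuous_on ?K (barycenter P)" "barycenter P \<in> ?K \<rightarrow> ?X"
    using continuous_on_barycenter barycenter by auto
  have "homotopic_with_canon (\<lambda>_. True) ?X ?X (barycenter P \<circ> coordinates P) id"
  proof (rule homotopic_with_linear)
    show "continuous_on ?X (barycenter P \<circ> coordinates P)"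
      using contX(1) continuous_on_barycenter by (rule continuous_on_compose)
    fix x assume "x \<in> ?X"
    then obtain S where "S \<in> P" "x \<in> S"
      by blast
    \<comment> \<open>The union \<open>?X\<close> need not be convex, but both endpoints lie in the
      same convex polytope \<open>S\<close>.\<close>
    then have "closed_segment ((barycenter P \<circ> coordinates P) x) (id x) \<subseteq> S"
      using coordinates barycenter convex by (intro closed_segment_subset) auto
    then show "closed_segment ((barycenter P \<circ> coordinates P) x) (id x) \<subseteq> ?X"
      using \<open>S \<in> P\<close> by blast
  qed (rule continuous_on_id')
  moreover have "homotopic_with_canon (\<lambda>_. True) ?K ?K (coordinates P \<circ> barycenter P) id"
  proof (rule homotopic_with_canon_pointwise_linear)
    show "continuous_on ?K (coordinates P \<circ> barycenter P)"
      using contK contX(1) by (intro continuous_on_compose) (auto intro: continuous_on_subset)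
    fix f and t :: real assume "f \<in> ?K" and t: "0 \<le> t" "t \<le> 1"
    then obtain S where "S \<in> P" "f \<in> vertex_distributions P S"
      by blast
    \<comment> \<open>The barycenter of \<open>f\<close> lies in \<open>S\<close>, so its
      coordinates are again supported in \<open>S\<close>: the segment stays in the simplex of
      \<open>S\<close>.\<close>
    then show "(\<lambda>v. (1 - t) * (coordinates P \<circ> barycenter P) f v + t * id f v) \<in> ?K"
      using coordinates barycenter t
      by (auto intro!: bexI[of _ S] vertex_distributions_convex_combination)
  qed (rule continuous_on_id')
  ultimately have "top_of_set ?X homotopy_equivalent_space top_of_set ?K"
    unfolding homotopy_equivalent_space_def using contX contK
    by (intro exI[of _ "coordinates P"] exI[of _ "barycenter P"]) auto
  then show ?thesis
    unfolding underlying_space_def geometric_realization_eq[OF fin assms(2)] .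
qed

end
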